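(* Let $m,n$ be positive integers, let $A$ be an $m\times n$ integer matrix, and let $\mathcal{L}=\mathrm{Ker}_{\mathbb{Z}}(A)\subset\mathbb{Z}^n$. The universal Markov basis of $A$ is a subset of the Graver basis of $A$ if and only if one of the following two conditions holds: (i) $\mathcal{L}$ is positive, i.e. $\mathcal{L}\cap\mathbb{N}^n=\{\mathbf{0}\}$; or (ii) $\mathcal{L}=\mathcal{L}_{pure}$ and $\mathrm{rank}\,\mathcal{L}=1$.
   Context: $\mathbb{N}$ contains $0$. Each $\mathbf{u}\in\mathbb{Z}^n$ is written uniquely as $\mathbf{u}=\mathbf{u}^+-\mathbf{u}^-$ with $\mathbf{u}^+,\mathbf{u}^-\in\mathbb{N}^n$ of disjoint support. Lattice ideal: $I_{\mathcal{L}}=\langle x^{\mathbf{u}}-x^{\mathbf{v}} : \mathbf{u},\mathbf{v}\in\mathbb{N}^n,\ A\mathbf{u}=A\mathbf{v}\rangle$ in the polynomial ring $K[x_1,\dots,x_n]$ over a field $K$. Markov basis of $A$: a finite subset $M\subset\mathcal{L}$ such that any $\mathbf{w},\mathbf{u}\in\mathbb{N}^n$ with $A\mathbf{w}=A\mathbf{u}$ can be connected by moves from $M$ (up to sign, repetitions allowed) with all partial sums remaining in $\mathbb{N}^n$; equivalently, such that $\{x^{\mathbf{u}^+}-x^{\mathbf{u}^-}:\mathbf{u}\in M\}$ generates $I_{\mathcal{L}}$. A Markov basis is minimal if no proper subset of it is a Markov basis. (Minimal Markov bases may have different cardinalities when $\mathcal{L}$ is not positive.) Universal Markov basis of $A$: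 the union of all minimal Markov bases of $A$ of minimal cardinality, where a vector $\mathbf{u}$ is identified with $-\mathbf{u}$. Graver basis of $A$: the set of all nonzero $\mathbf{u}\in\mathcal{L}$ having no conformal decomposition, i.e. which cannot be written as $\mathbf{u}=\mathbf{v}+\mathbf{w}$ with $\mathbf{v},\mathbf{w}\in\mathcal{L}$ nonzero, $\mathbf{u}^+=\mathbf{v}^++\mathbf{w}^+$ and $\mathbf{u}^-=\mathbf{v}^-+\mathbf{w}^-$. $\mathcal{L}_{pure}$ is the sublattice of $\mathcal{L}$ generated by $\mathcal{L}\cap\mathbb{N}^n$. *)

theory Defs
  imports "HOL-Analysis.Analysis"
begin

text \<open>Integer vectors as a \<open>\<int>\<close>-module: sublattices of \<open>\<int>\<^sup>n\<close> are its subspaces,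
  and \<open>zvec.span S\<close> is the sublattice generated by \<open>S\<close>.\<close>

interpretation zvec: module "(*s) :: int \<Rightarrow> int ^ 'n \<Rightarrow> int ^ 'n"
  by standard (simp_all add: vec_eq_iff algebra_simps)

definition lattice_ker :: "int ^ 'n ^ 'm \<Rightarrow> (int ^ 'n) set" where
  "lattice_ker A = {u. A *v u = 0}"

definition nat_vecs :: "(int ^ 'n) set" where
  "nat_vecs = {u. \<forall>i. 0 \<le> u $ i}"

definition pos_part :: "int ^ 'n \<Rightarrow> int ^ 'n" where
  "pos_part u = (\<chi> i. max (u $ i) 0)"

definition neg_part :: "int ^ 'n \<Rightarrow> int ^ 'n" where
  "neg_part u = (\<chi> i. max (- u $ i) 0)"

definition move_step :: "(int ^ 'n) set \<Rightarrow> (int ^ 'n) rel" where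
  "move_step M = {(x, y). x \<in> nat_vecs \<and> y \<in> nat_vecs \<and> (y - x \<in> M \<or> x - y \<in> M)}"

definition markov_basis :: "int ^ 'n ^ 'm \<Rightarrow> (int ^ 'n) set \<Rightarrow> bool" where
  "markov_basis A M \<longleftrightarrow> finite M \<and> M \<subseteq> lattice_ker A \<and>
     (\<forall>w\<in>nat_vecs. \<forall>u\<in>nat_vecs. A *v w = A *v u \<longrightarrow> (w, u) \<in> (move_step M)\<^sup>*)"

definition minimal_markov_basis :: "int ^ 'n ^ 'm \<Rightarrow> (int ^ 'n) set \<Rightarrow> bool" where
  "minimal_markov_basis A M \<longleftrightarrow>
     markov_basis A M \<and> (\<forall>M'. M' \<subset> M \<longrightarrow> \<not> markov_basis A M')"

text \<open>The vectors \<open>u\<close> and \<open>- u\<close> are to be identified. No quotient is needed: replacing elements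
  by their negatives preserves all the notions above, and a minimal Markov basis never contains
  both \<open>u\<close> and \<open>- u\<close>. Hence cardinalities are those counted up to sign, and the union
  below is closed under negation, i.e. it is the full preimage of the set of classes.\<close>

definition universal_markov_basis :: "int ^ 'n ^ 'm \<Rightarrow> (int ^ 'n) set" where
  "universal_markov_basis A =
     \<Union> {M. minimal_markov_basis A M \<and> (\<forall>M'. minimal_markov_basis A M' \<longrightarrow> card M \<le> card M')}"

definition graver_basis :: "int ^ 'n ^ 'm \<Rightarrow> (int ^ 'n) set" where
  "graver_basis A = {u \<in> lattice_ker A. u \<noteq> 0 \<and>
     \<not> (\<exists>v\<in>lattice_ker A. \<exists>w\<in>lattice_ker A. v \<noteq> 0 \<and> w \<noteq> 0 \<and> u = v + w \<and>
          pos_part u = pos_part v + pos_part w \<and> neg_part u = neg_part v + neg_part w)}"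

definition pure_sublattice :: "(int ^ 'n) set \<Rightarrow> (int ^ 'n) set" where
  "pure_sublattice L = zvec.span (L \<inter> nat_vecs)"

definition positive_lattice :: "(int ^ 'n) set \<Rightarrow> bool" where
  "positive_lattice L \<longleftrightarrow> L \<inter> nat_vecs = {0}"

text \<open>The rank of an abelian group: the largest size of a \<open>\<int>\<close>-linearly independent subset.
  In \<open>\<int>\<^sup>n\<close> these sizes are bounded by \<open>n\<close>, so the maximum exists.\<close>

definition lattice_rank :: "(int ^ 'n) set \<Rightarrow> nat" where
  "lattice_rank L = Max {card B | B. finite B \<and> B \<subseteq> L \<and> zvec.independent B}"

end

theory Submission
  imports Defs
begin

text \<open>If \<open>L\<close> is positive and \<open>u = v + w\<close> is a conformal decomposition of an element of a
  minimal Markov basis \<open>M\<close>, then \<open>v\<^sup>+\<close> is joined to \<open>v\<^sup>-\<close> and \<open>w\<^sup>+\<close> to \<open>w\<^sup>-\<close> without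
  using \<open>u\<close>; translating these paths joins \<open>u\<^sup>+\<close> to \<open>u\<^sup>-\<close>, so \<open>u\<close> was redundant.
  If \<open>L\<close> is not positive, let \<open>M\<close> be a Markov basis of least cardinality, which exists by
  Dickson's lemma. The first step of a path from \<open>0\<close> to a nonzero element of \<open>L \<inter> \<nat>\<^sup>n\<close>
  shows that \<open>M\<close> contains up to sign some nonzero \<open>h \<in> \<nat>\<^sup>n\<close>. Any other element \<open>u\<close> of \<open>M\<close>
  may be replaced by \<open>u + k h\<close>, because \<open>h\<close> is still joined to \<open>0\<close>; for large \<open>k\<close> this is not
  in the Graver basis. So if the universal Markov basis lies in the Graver basis, then
  \<open>h\<close> up to sign is the only element of \<open>M\<close> and \<open>L = \<int> h\<close>.\<close>

section \<open>Closure properties of the lattice and of the nonnegative vectors\<close>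

lemma lattice_ker_subspace: "zvec.subspace (lattice_ker A)"
proof -
  have "A *v (c *s x) = c *s (A *v x)" for c x
    by (simp add: vec_eq_iff matrix_vector_mult_def sum_distrib_left mult.left_commute)
  then show ?thesis
    by (auto simp: zvec.subspace_def lattice_ker_def matrix_vector_right_distrib)
qed

lemmas lattice_ker_0 = zvec.subspace_0[OF lattice_ker_subspace]
  and lattice_ker_add = zvec.subspace_add[OF lattice_ker_subspace]
  and lattice_ker_diff = zvec.subspace_diff[OF lattice_ker_subspace]
  and lattice_ker_neg = zvec.subspace_neg[OF lattice_ker_subspace]
  and lattice_ker_scale = zvec.subspace_scale[OF lattice_ker_subspace]

lemma diff_in_lattice_ker_iff: "x - y \<in> lattice_ker A \<longleftrightarrow> A *v x = A *v y"
  by (simp add: lattice_ker_def matrix_vector_mult_diff_distrib)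

lemma pos_part_nat_vecs: "pos_part u \<in> nat_vecs"
  by (simp add: nat_vecs_def pos_part_def)

lemma neg_part_nat_vecs: "neg_part u \<in> nat_vecs"
  by (simp add: nat_vecs_def neg_part_def)

lemma pos_part_minus_neg_part: "pos_part u - neg_part u = u"
  by (auto simp: vec_eq_iff pos_part_def neg_part_def)

lemma nat_vecs_add: "x \<in> nat_vecs \<Longrightarrow> y \<in> nat_vecs \<Longrightarrow> x + y \<in> nat_vecs"
  by (simp add: nat_vecs_def)

lemma nat_vecs_0: "0 \<in> nat_vecs"
  by (simp add: nat_vecs_def)

lemma nat_vecs_scale: "x \<in> nat_vecs \<Longrightarrow> 0 \<le> k \<Longrightarrow> k *s x \<in> nat_vecs"
  by (simp add: nat_vecs_def)

lemma nat_vecs_add_eq_0: "x \<in> nat_vecs \<Longrightarrow> y \<in> nat_vecs \<Longrightarrow> x + y = 0 \<Longrightarrow> x = 0"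
  by (simp add: nat_vecs_def vec_eq_iff) (metis add_nonneg_eq_0_iff)

lemma sum_nat_vecs_pos:
  assumes "x \<in> nat_vecs" "x \<noteq> 0"
  shows "0 < (\<Sum>i\<in>UNIV. x $ i)"
proof -
  have "(\<Sum>i\<in>UNIV. x $ i) \<noteq> 0"
    using assms by (subst sum_nonneg_eq_0_iff) (auto simp: nat_vecs_def vec_eq_iff)
  moreover have "0 \<le> (\<Sum>i\<in>UNIV. x $ i)"
    using assms by (intro sum_nonneg) (auto simp: nat_vecs_def)
  ultimately show ?thesis by linarith
qed

section \<open>Connectivity by moves\<close>

lemma sym_move_steps: "sym ((move_step M)\<^sup>*)"
  by (rule sym_rtrancl) (auto simp: sym_def move_step_def)

lemma move_steps_translate:
  assumes "(x, y) \<in> (move_step M)\<^sup>*" "z \<in> nat_vecs"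
  shows "(x + z, y + z) \<in> (move_step M)\<^sup>*"
  using assms(1)
proof induction
  case (step y y')
  then have "(y + z, y' + z) \<in> move_step M"
    using assms(2) by (auto simp: move_step_def nat_vecs_add)
  with step show ?case by (meson rtrancl.rtrancl_into_rtrancl)
qed simp

lemma move_steps_diff_subspace:
  assumes "(x, y) \<in> (move_step M)\<^sup>*" "zvec.subspace S" "M \<subseteq> S"
  shows "x - y \<in> S"
  using assms(1)
proof induction
  case base
  then show ?case using assms by (simp add: zvec.subspace_0)
next
  case (step y z)
  from step(2) have "y - z \<in> S"
    using assms(2,3) zvec.subspace_neg[OF assms(2)]
    by (auto simp: move_step_def) (metis minus_diff_eq subsetD)
  then show ?case using step.IH zvec.subspace_add[OF assms(2)] by fastforce
qed

text \<open>It suffices to realise the move from v^+ to v^- for each v in \<open>M\<close>: every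
  other application of v is a translate of it by a nonnegative vector.\<close>

lemma markov_basis_transfer:
  assumes M: "markov_basis A M" and N: "finite N" "N \<subseteq> lattice_ker A"
    and conn: "\<And>v. v \<in> M \<Longrightarrow> (pos_part v, neg_part v) \<in> (move_step N)\<^sup>*"
  shows "markov_basis A N"
proof -
  have down: "(x, y) \<in> (move_step N)\<^sup>*"
    if "x \<in> nat_vecs" "y \<in> nat_vecs" "x - y \<in> M" for x y
  proof -
    \<comment> \<open>\<open>t\<close> is the coordinatewise minimum of \<open>x\<close> and
      \<open>y\<close>.\<close>
    define t where "t = x - pos_part (x - y)"
    have t: "t \<in> nat_vecs"
      using that by (auto simp: t_def nat_vecs_def pos_part_def)
    have "pos_part (x - y) + t = x" "neg_part (x - y) + t = y"
      by (auto simp: t_def vec_eq_iff pos_part_def neg_part_def max_def)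
    with move_steps_translate[OF conn[OF that(3)] t] show ?thesis by simp
  qed
  have "move_step M \<subseteq> (move_step N)\<^sup>*"
    using down sym_move_steps[of N] by (auto simp: move_step_def sym_def)
  then have "(move_step M)\<^sup>* \<subseteq> (move_step N)\<^sup>*"
    by (metis rtrancl_idemp rtrancl_mono)
  then show ?thesis using M N by (auto simp: markov_basis_def)
qed

lemma markov_basis_pos_neg:
  assumes "markov_basis A M" "v \<in> lattice_ker A"
  shows "(pos_part v, neg_part v) \<in> (move_step M)\<^sup>*"
proof -
  have "A *v pos_part v = A *v neg_part v"
    using assms(2) by (metis diff_in_lattice_ker_iff pos_part_minus_neg_part)
  then show ?thesis
    using assms(1) by (simp add: markov_basis_def pos_part_nat_vecs neg_part_nat_vecs)
qed

text \<open>The differences along a path from v^+ to v^- lie in \<open>S\<close> and telescope to v.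
  With \<open>S\<close> the span of \<open>M\<close>, a Markov basis generates the lattice as a
  group.\<close>

lemma markov_basis_subspace:
  assumes "markov_basis A M" "zvec.subspace S" "M \<subseteq> S"
  shows "lattice_ker A \<subseteq> S"
proof
  fix v assume "v \<in> lattice_ker A"
  from move_steps_diff_subspace[OF markov_basis_pos_neg[OF assms(1) this] assms(2,3)]
  show "v \<in> S" by (simp add: pos_part_minus_neg_part)
qed

section \<open>Dickson's lemma and the existence of a Markov basis\<close>

text \<open>This is the product order on the pairs (v^+, v^-), read as vectors of 2n natural
  numbers; in this form Dickson's lemma applies directly.\<close>

definition conformal_le :: "int ^ 'n \<Rightarrow> int ^ 'n \<Rightarrow> bool" where
  "conformal_le v z \<longleftrightarrow>
     (\<forall>i. max (v $ i) 0 \<le> max (z $ i) 0 \<and> max (- v $ i) 0 \<le> max (- z $ i) 0)"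

text \<open>Every sequence has a monotone subsequence, and a decreasing sequence of natural numbers
  is constant once it reaches its least value.\<close>

lemma nat_seq_incseq_subseq:
  fixes f :: "nat \<Rightarrow> nat"
  obtains r where "strict_mono r" "incseq (f \<circ> r)"
proof -
  obtain r where r: "strict_mono r" "monoseq (\<lambda>n. f (r n))"
    using seq_monosub[of f] by (auto simp: o_def)
  from r(2) consider "incseq (f \<circ> r)" | "decseq (f \<circ> r)"
    by (auto simp: monoseq_iff o_def)
  then show ?thesis
  proof cases
    case 1
    with r(1) that show ?thesis by blast
  next
    case 2
    obtain k where k: "\<And>n. f (r k) \<le> f (r n)"
      using ex_has_least_nat[of "\<lambda>_. True" 0 "\<lambda>n. f (r n)"] by auto
    have "f (r (n + k)) = f (r k)" for n
      using 2 k[of "n + k"] by (simp add: decseq_def le_antisym)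
    then have "incseq (f \<circ> (\<lambda>n. r (n + k)))" by (simp add: incseq_def)
    moreover have "strict_mono (\<lambda>n. r (n + k))"
      using r(1) by (simp add: strict_mono_def)
    ultimately show ?thesis using that by blast
  qed
qed

lemma finite_family_incseq_subseq:
  fixes f :: "'i \<Rightarrow> nat \<Rightarrow> nat"
  assumes "finite I"
  shows "\<exists>r. strict_mono r \<and> (\<forall>i\<in>I. incseq (f i \<circ> r))"
  using assms
proof induction
  case empty
  show ?case using strict_mono_id by blast
next
  case (insert j I)
  then obtain r where r: "strict_mono r" "\<forall>i\<in>I. incseq (f i \<circ> r)" by blast
  obtain s where s: "strict_mono s" "incseq ((f j \<circ> r) \<circ> s)"
    by (rule nat_seq_incseq_subseq)
  have "incseq (f i \<circ> (r \<circ> s))" if "i \<in> insert j I" for i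
    using that r s by (auto simp: incseq_def strict_mono_less_eq)
  with strict_mono_o[OF r(1) s(1)] show ?case by blast
qed

text \<open>Dickson's lemma for signed vectors: along a suitable subsequence all entries of the
  positive and negative parts increase.\<close>

lemma conformal_le_sequence:
  fixes f :: "nat \<Rightarrow> int ^ 'n"
  obtains i j where "i < j" "conformal_le (f i) (f j)"
proof -
  \<comment> \<open>The flag selects the sign, and \<open>nat\<close> sends negative numbers to 0,
    so \<open>g\<close> lists the entries of the positive and negative parts.\<close>
  define g where "g = (\<lambda>(i, b) k. nat (if b then f k $ i else - f k $ i))"
  obtain r where r: "strict_mono r" "\<And>p. incseq (g p \<circ> r)"
    using finite_family_incseq_subseq[of "UNIV :: ('n \<times> bool) set" g] by auto
  have "conformal_le (f (r 0)) (f (r 1))"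
    unfolding conformal_le_def
  proof (intro allI conjI)
    fix i
    show "max (f (r 0) $ i) 0 \<le> max (f (r 1) $ i) 0"
    proof -
      have "nat (f (r 0) $ i) \<le> nat (f (r 1) $ i)"
        using incseqD[OF r(2)[of "(i, True)"], of 0 1] by (simp add: g_def)
      then show ?thesis by arith
    qed
    show "max (- f (r 0) $ i) 0 \<le> max (- f (r 1) $ i) 0"
    proof -
      have "nat (- f (r 0) $ i) \<le> nat (- f (r 1) $ i)"
        using incseqD[OF r(2)[of "(i, False)"], of 0 1] by (simp add: g_def)
      then show ?thesis by arith
    qed
  qed
  moreover have "r 0 < r 1" using r(1) by (simp add: strict_mono_def)
  ultimately show ?thesis using that by blast
qed

text \<open>Nonzero entries of \<open>v\<close> have the sign of those of \<open>z\<close> and are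
  no larger in absolute value, so subtracting \<open>v\<close> never overshoots 0.\<close>

lemma conformal_le_diff_decrease:
  assumes "conformal_le v z" "v \<noteq> 0"
  shows "(\<Sum>i\<in>UNIV. \<bar>(z - v) $ i\<bar>) < (\<Sum>i\<in>UNIV. \<bar>z $ i\<bar>)"
proof (rule sum_strict_mono_ex1)
  have c: "max (v $ i) 0 \<le> max (z $ i) 0" "max (- v $ i) 0 \<le> max (- z $ i) 0" for i
    using assms(1) by (auto simp: conformal_le_def)
  show "\<forall>i\<in>UNIV. \<bar>(z - v) $ i\<bar> \<le> \<bar>z $ i\<bar>"
  proof
    show "\<bar>(z - v) $ i\<bar> \<le> \<bar>z $ i\<bar>" for i
      using c[of i] unfolding vector_minus_component vector_uminus_component by linarith
  qed
  from assms(2) obtain i where "v $ i \<noteq> 0" by (auto simp: vec_eq_iff)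
  then have "\<bar>(z - v) $ i\<bar> < \<bar>z $ i\<bar>"
    using c[of i] unfolding vector_minus_component vector_uminus_component by linarith
  then show "\<exists>i\<in>UNIV. \<bar>(z - v) $ i\<bar> < \<bar>z $ i\<bar>" by blast
qed simp

lemma conformal_le_trans: "conformal_le u v \<Longrightarrow> conformal_le v z \<Longrightarrow> conformal_le u z"
  unfolding conformal_le_def by (meson order_trans)

lemma conformal_le_norm:
  assumes "conformal_le v z" "v \<noteq> z"
  shows "(\<Sum>i\<in>UNIV. \<bar>v $ i\<bar>) < (\<Sum>i\<in>UNIV. \<bar>z $ i\<bar>)"
proof -
  \<comment> \<open>Since z - (z - v) = v, the strict decrease can be applied to
    \<open>z - v\<close> in place of \<open>v\<close>.\<close>
  have "conformal_le (z - v) z"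
    unfolding conformal_le_def
  proof
    fix i
    have "max (v $ i) 0 \<le> max (z $ i) 0" "max (- v $ i) 0 \<le> max (- z $ i) 0"
      using assms(1) by (auto simp: conformal_le_def)
    then show "max ((z - v) $ i) 0 \<le> max (z $ i) 0 \<and> max (- (z - v) $ i) 0 \<le> max (- z $ i) 0"
      unfolding vector_minus_component vector_uminus_component by linarith
  qed
  from conformal_le_diff_decrease[OF this] assms(2) show ?thesis by simp
qed

text \<open>Distinct minimal elements are incomparable, so infinitely many of them would contradict
  Dickson's lemma.\<close>

lemma finite_conformal_minimal:
  fixes L :: "(int ^ 'n) set"
  shows "finite {z \<in> L. z \<noteq> 0 \<and> (\<forall>v\<in>L. v \<noteq> 0 \<longrightarrow> conformal_le v z \<longrightarrow> v = z)}" (is "finite ?M")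
proof (rule ccontr)
  assume "infinite ?M"
  then obtain f :: "nat \<Rightarrow> int ^ 'n" where f: "inj f" "range f \<subseteq> ?M"
    using infinite_countable_subset by blast
  obtain i j where ij: "i < j" "conformal_le (f i) (f j)" by (rule conformal_le_sequence)
  then have "f i = f j" using f(2) by blast
  with f(1) ij(1) show False by (simp add: inj_eq)
qed

lemma conformal_minimal_below:
  fixes L :: "(int ^ 'n) set"
  assumes "z \<in> L" "z \<noteq> 0"
  obtains m where "m \<in> L" "m \<noteq> 0" "conformal_le m z"
    "\<forall>v\<in>L. v \<noteq> 0 \<longrightarrow> conformal_le v m \<longrightarrow> v = m"
proof -
  let ?P = "\<lambda>m. m \<in> L \<and> m \<noteq> 0 \<and> conformal_le m z"
  let ?n = "\<lambda>m::int^'n. nat (\<Sum>i\<in>UNIV. \<bar>m $ i\<bar>)"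
  have "?P z" using assms by (simp add: conformal_le_def)
  from ex_has_least_nat[of ?P, OF this, of ?n]
  obtain m where m: "?P m" and least: "\<And>v. ?P v \<Longrightarrow> ?n m \<le> ?n v" by blast
  have "v = m" if "v \<in> L" "v \<noteq> 0" "conformal_le v m" for v
  proof (rule ccontr)
    assume "v \<noteq> m"
    with that conformal_le_norm have "(\<Sum>i\<in>UNIV. \<bar>v $ i\<bar>) < (\<Sum>i\<in>UNIV. \<bar>m $ i\<bar>)" by blast
    moreover have "0 \<le> (\<Sum>i\<in>UNIV. \<bar>v $ i\<bar>)" by (simp add: sum_nonneg)
    moreover have "?n m \<le> ?n v" using least that m conformal_le_trans by blast
    ultimately show False by linarith
  qed
  with m that show ?thesis by blast
qed

text \<open>The witness is the Graver basis, described as the conformally minimal nonzero lattice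
  vectors. A minimal vector below u - w moves w strictly closer to u in the 1-norm.\<close>

lemma markov_basis_exists: "\<exists>M. markov_basis A M"
proof -
  let ?L = "lattice_ker A"
  define M where "M = {z \<in> ?L. z \<noteq> 0 \<and> (\<forall>v\<in>?L. v \<noteq> 0 \<longrightarrow> conformal_le v z \<longrightarrow> v = z)}"
  have "(w, u) \<in> (move_step M)\<^sup>*"
    if "w \<in> nat_vecs" "u \<in> nat_vecs" "u - w \<in> ?L" for w u
    using that
  proof (induction "nat (\<Sum>i\<in>UNIV. \<bar>(u - w) $ i\<bar>)" arbitrary: w rule: less_induct)
    case less
    show ?case
    proof (cases "u = w")
      case False
      then have "u - w \<noteq> 0" by simp
      with less.prems(3) obtain m where m: "m \<in> ?L" "m \<noteq> 0" "conformal_le m (u - w)"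
        "\<forall>v\<in>?L. v \<noteq> 0 \<longrightarrow> conformal_le v m \<longrightarrow> v = m"
        by (rule conformal_minimal_below)
      then have mM: "m \<in> M" by (simp add: M_def)
      \<comment> \<open>Where \<open>m\<close> is negative, so is \<open>u - w\<close>, and -m_i
        \<le> w_i - u_i \<le> w_i.\<close>
      have "0 \<le> w $ i + m $ i" for i
      proof -
        have "max (- m $ i) 0 \<le> max (- (u - w) $ i) 0" "0 \<le> w $ i" "0 \<le> u $ i"
          using m(3) less.prems by (auto simp: conformal_le_def nat_vecs_def)
        then show ?thesis by auto
      qed
      then have wm: "w + m \<in> nat_vecs" by (simp add: nat_vecs_def)
      have diff: "u - (w + m) = (u - w) - m" by simp
      have "(\<Sum>i\<in>UNIV. \<bar>((u - w) - m) $ i\<bar>) < (\<Sum>i\<in>UNIV. \<bar>(u - w) $ i\<bar>)"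
        using conformal_le_diff_decrease m by blast
      moreover have "0 \<le> (\<Sum>i\<in>UNIV. \<bar>((u - w) - m) $ i\<bar>)" by (simp add: sum_nonneg)
      ultimately have "nat (\<Sum>i\<in>UNIV. \<bar>(u - (w + m)) $ i\<bar>) < nat (\<Sum>i\<in>UNIV. \<bar>(u - w) $ i\<bar>)"
        unfolding diff by linarith
      moreover have "u - (w + m) \<in> ?L"
        unfolding diff by (rule lattice_ker_diff[OF less.prems(3) m(1)])
      ultimately have "(w + m, u) \<in> (move_step M)\<^sup>*"
        using less.hyps[OF _ wm less.prems(2)] by blast
      moreover have "(w, w + m) \<in> move_step M"
        using wm less.prems(1) mM by (simp add: move_step_def)
      ultimately show ?thesis by (meson converse_rtrancl_into_rtrancl)
    qed simp
  qed
  moreover have "finite M" unfolding M_def by (rule finite_conformal_minimal)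
  moreover have "M \<subseteq> ?L" by (auto simp: M_def)
  ultimately have "markov_basis A M"
    unfolding markov_basis_def by (metis diff_in_lattice_ker_iff)
  then show ?thesis ..
qed

section \<open>Minimal Markov bases, and the case of a positive lattice\<close>

lemma least_markov_basis_subset_universal:
  assumes "markov_basis A M" "\<And>M'. markov_basis A M' \<Longrightarrow> card M \<le> card M'"
  shows "M \<subseteq> universal_markov_basis A"
proof -
  have "finite M" using assms(1) by (simp add: markov_basis_def)
  then have "minimal_markov_basis A M"
    unfolding minimal_markov_basis_def using assms by (meson psubset_card_mono leD)
  then show ?thesis
    unfolding universal_markov_basis_def using assms(2) minimal_markov_basis_def by blast
qed

lemma minimal_markov_basis_subset_graver:
  assumes pos: "positive_lattice (lattice_ker A)" and M: "minimal_markov_basis A M"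
  shows "M \<subseteq> graver_basis A"
proof
  fix u assume u: "u \<in> M"
  let ?L = "lattice_ker A"
  have mb: "markov_basis A M" and min: "\<not> markov_basis A (M - {u})"
    using M u by (auto simp: minimal_markov_basis_def)
  have uL: "u \<in> ?L" and fin: "finite M" and M_sub: "M \<subseteq> ?L"
    using mb u by (auto simp: markov_basis_def)
  \<comment> \<open>Every other element of \<open>M\<close> still provides its own one-step
    connection, so a detour for \<open>u\<close> alone would contradict minimality.\<close>
  have removable: False if conn: "(pos_part u, neg_part u) \<in> (move_step (M - {u}))\<^sup>*"
  proof -
    have "markov_basis A (M - {u})"
    proof (rule markov_basis_transfer[OF mb])
      fix v assume v: "v \<in> M"
      show "(pos_part v, neg_part v) \<in> (move_step (M - {u}))\<^sup>*"
      proof (cases "v = u")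
        case False
        then have "(pos_part v, neg_part v) \<in> move_step (M - {u})"
          using v by (simp add: move_step_def pos_part_nat_vecs neg_part_nat_vecs
              pos_part_minus_neg_part)
        then show ?thesis by blast
      qed (use conn in simp)
    qed (use fin M_sub in auto)
    with min show False ..
  qed
  have u0: "u \<noteq> 0"
  proof
    assume "u = 0"
    then have "pos_part u = neg_part u" by (simp add: pos_part_def neg_part_def)
    then show False using removable by simp
  qed
  \<comment> \<open>In a positive lattice a nonzero vector has entries of both signs.\<close>
  have no_zero: "pos_part v \<noteq> 0 \<and> neg_part v \<noteq> 0" if "v \<in> ?L" "v \<noteq> 0" for v
  proof -
    have "- v \<in> ?L" "- v \<noteq> 0" using that by (simp_all add: lattice_ker_neg)
    then have "v \<notin> nat_vecs" "- v \<notin> nat_vecs"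
      using that pos unfolding positive_lattice_def by blast+
    moreover have "v \<in> nat_vecs" if "neg_part v = 0"
      using that pos_part_minus_neg_part[of v] pos_part_nat_vecs[of v] by simp
    moreover have "- v \<in> nat_vecs" if "pos_part v = 0"
      using that pos_part_minus_neg_part[of v] neg_part_nat_vecs[of v]
      by (metis diff_0 minus_minus)
    ultimately show ?thesis by blast
  qed
  have avoid: "(pos_part v, neg_part v) \<in> (move_step (M - {u}))\<^sup>*"
    if v: "v \<in> ?L" and w: "w \<in> ?L" "w \<noteq> 0" and dec: "u = v + w"
      and decp: "pos_part u = pos_part v + pos_part w" for v w
  proof -
    \<comment> \<open>A step along \<open>\<plusminus>u\<close> would start at some \<open>x \<ge> u\<^sup>\<plusminus>\<close> in the fiber of \<open>v\<^sup>+\<close>; then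
      \<open>x - u\<^sup>\<plusminus> + w\<^sup>+\<close> is a nonzero nonnegative vector of the lattice.\<close>
    have no: False if "x \<in> nat_vecs" "y \<in> nat_vecs" "x - y = u" "pos_part v - x \<in> ?L" for x y
    proof -
      define t where "t = x - pos_part u"
      have t: "t \<in> nat_vecs"
        using that by (auto simp: t_def nat_vecs_def pos_part_def)
      have "t + pos_part w = - (pos_part v - x)" by (simp add: t_def decp)
      then have "t + pos_part w \<in> ?L" using lattice_ker_neg that(4) by metis
      then have "pos_part w + t = 0"
        using pos nat_vecs_add[OF t pos_part_nat_vecs[of w]]
        by (auto simp: positive_lattice_def add.commute)
      then have "pos_part w = 0"
        using nat_vecs_add_eq_0 t pos_part_nat_vecs by blast
      then show False using no_zero w by blast
    qed
    have "(pos_part v, x) \<in> (move_step (M - {u}))\<^sup>*"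
      if "(pos_part v, x) \<in> (move_step M)\<^sup>*" for x
      using that
    proof induction
      case (step x y)
      have x: "pos_part v - x \<in> ?L"
        using move_steps_diff_subspace[OF step(1) lattice_ker_subspace M_sub] .
      have y: "pos_part v - y \<in> ?L"
        using move_steps_diff_subspace[OF _ lattice_ker_subspace M_sub] step(1,2)
        by (meson rtrancl.rtrancl_into_rtrancl)
      \<comment> \<open>A step may use \<open>u\<close> in either direction, so both of its ends are
        needed in the fiber of v^+.\<close>
      have "x - y \<noteq> u" "y - x \<noteq> u"
        using no[of x y] no[of y x] step(2) x y by (auto simp: move_step_def)
      then have "(x, y) \<in> move_step (M - {u})"
        using step(2) by (auto simp: move_step_def)
      with step.IH show ?case by (rule rtrancl_into_rtrancl)
    qed simp
    then show ?thesis using markov_basis_pos_neg[OF mb v] by blast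
  qed
  show "u \<in> graver_basis A"
    unfolding graver_basis_def
  proof (intro CollectI conjI notI)
    assume "\<exists>v\<in>?L. \<exists>w\<in>?L. v \<noteq> 0 \<and> w \<noteq> 0 \<and> u = v + w \<and>
          pos_part u = pos_part v + pos_part w \<and> neg_part u = neg_part v + neg_part w"
    then obtain v w where vw: "v \<in> ?L" "w \<in> ?L" "v \<noteq> 0" "w \<noteq> 0" "u = v + w"
      "pos_part u = pos_part v + pos_part w" "neg_part u = neg_part v + neg_part w" by blast
    \<comment> \<open>The detour runs from v^+ + w^+ through v^- + w^+ to v^- + w^-.\<close>
    have "(pos_part v + pos_part w, neg_part v + pos_part w) \<in> (move_step (M - {u}))\<^sup>*"
      using avoid[of v w] vw move_steps_translate pos_part_nat_vecs by blast
    moreover have "(pos_part w + neg_part v, neg_part w + neg_part v) \<in> (move_step (M - {u}))\<^sup>*"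
      using avoid[of w v] vw move_steps_translate neg_part_nat_vecs by (metis add.commute)
    ultimately have "(pos_part u, neg_part u) \<in> (move_step (M - {u}))\<^sup>*"
      using vw by (metis add.commute rtrancl_trans)
    then show False by (rule removable)
  qed (use uL u0 in auto)
qed

section \<open>Rank, and lattices of rank one\<close>

lemma common_denominator:
  fixes f :: "'a \<Rightarrow> rat"
  assumes "finite B"
  shows "\<exists>d::int. d \<noteq> 0 \<and> (\<forall>v\<in>B. of_int d * f v \<in> \<int>)"
  using assms
proof induction
  case (insert x B)
  then obtain d :: int where d: "d \<noteq> 0" "\<forall>v\<in>B. of_int d * f v \<in> \<int>" by blast
  obtain a b where ab: "b > 0" "f x = of_int a / of_int b"
    by (metis quotient_of_denom_pos quotient_of_div surj_pair)
  have "of_int (b * d) * f v \<in> \<int>" if "v \<in> insert x B" for v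
  proof (cases "v = x")
    case True
    then have "of_int (b * d) * f v = of_int (d * a)" using ab by simp
    then show ?thesis by (metis Ints_of_int)
  next
    case False
    then have "of_int d * f v \<in> \<int>" using that d(2) by blast
    then have "of_int b * (of_int d * f v) \<in> \<int>" by (rule Ints_mult[OF Ints_of_int])
    then show ?thesis by (simp add: mult.assoc)
  qed
  then show ?case using ab(1) d(1) by (intro exI[of _ "b * d"]) auto
qed (auto intro: exI[of _ 1])

text \<open>A rational dependence between integer vectors becomes an integral one after clearing
  denominators, so the dimension of the rational space bounds the size.\<close>

lemma zvec_independent_card_le:
  fixes B :: "(int ^ 'n) set"
  assumes fin: "finite B" and ind: "zvec.independent B"
  shows "card B \<le> CARD('n)"
proof -
  define e :: "int ^ 'n \<Rightarrow> rat ^ 'n" where "e v = (\<chi> i. of_int (v $ i))" for v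
  have inj: "inj e" by (auto simp: inj_def e_def vec_eq_iff)
  have "\<not> vec.dependent (e ` B)"
  proof
    assume "vec.dependent (e ` B)"
    then obtain c w where c: "w \<in> B" "c (e w) \<noteq> 0" "(\<Sum>x\<in>e ` B. c x *s x) = 0"
      using fin by (auto simp: vec.dependent_finite)
    obtain d :: int where d: "d \<noteq> 0" "\<forall>v\<in>B. of_int d * c (e v) \<in> \<int>"
      using common_denominator[OF fin, of "\<lambda>v. c (e v)"] by blast
    \<comment> \<open>The argument of the floor is an integer on \<open>B\<close>, so rounding
      changes nothing there.\<close>
    define k where "k v = \<lfloor>of_int d * c (e v)\<rfloor>" for v
    have k: "of_int (k v) = of_int d * c (e v)" if "v \<in> B" for v
      using d(2) that by (auto simp: k_def elim: Ints_cases)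
    have "(\<Sum>v\<in>B. k v *s v) = 0"
      unfolding vec_eq_iff
    proof
      fix i
      have "(\<Sum>v\<in>B. c (e v) * of_int (v $ i)) = (\<Sum>x\<in>e ` B. c x *s x) $ i"
        using inj by (subst sum.reindex) (auto simp: inj_on_def inj_def e_def)
      then have "(\<Sum>v\<in>B. c (e v) * of_int (v $ i)) = 0" using c(3) by simp
      then have "of_int d * (\<Sum>v\<in>B. c (e v) * of_int (v $ i)) = 0" by simp
      then have "(of_int (\<Sum>v\<in>B. k v * v $ i) :: rat) = 0"
        by (simp add: sum_distrib_left k mult.assoc)
      then show "(\<Sum>v\<in>B. k v *s v) $ i = 0 $ i"
        by (simp only: of_int_eq_0_iff) simp
    qed
    then have "k w = 0" using zvec.independentD[OF ind fin subset_refl] c(1) by blast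
    then show False using k[OF c(1)] c(2) d(1) by simp
  qed
  then have "card (e ` B) \<le> vec.dim (UNIV :: (rat ^ 'n) set)"
    by (intro vec.independent_card_le_dim) auto
  then have "card (e ` B) \<le> CARD('n)" unfolding vec_dim_card .
  then show ?thesis
    using inj by (metis card_image inj_on_subset subset_UNIV)
qed

lemma card_le_lattice_rank:
  assumes "finite B" "B \<subseteq> L" "zvec.independent B"
  shows "card B \<le> lattice_rank (L :: (int ^ 'n) set)"
  unfolding lattice_rank_def
proof (rule Max_ge)
  show "finite {card B | B. finite B \<and> B \<subseteq> L \<and> zvec.independent B}"
    by (rule finite_subset[of _ "{..CARD('n)}"]) (auto intro: zvec_independent_card_le)
qed (use assms in blast)

lemma zvec_dependent_pair_iff:
  assumes "p \<noteq> u"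
  shows "zvec.dependent {p, u} \<longleftrightarrow> (\<exists>a b. (a \<noteq> 0 \<or> b \<noteq> 0) \<and> a *s p + b *s u = 0)"
    (is "_ \<longleftrightarrow> ?R")
proof
  assume "zvec.dependent {p, u}"
  then show ?R using assms by (auto simp: zvec.dependent_finite)
next
  assume ?R
  then obtain a b where "a \<noteq> 0 \<or> b \<noteq> 0" "a *s p + b *s u = 0" by blast
  then show "zvec.dependent {p, u}"
    using assms by (auto simp: zvec.dependent_finite intro!: exI[of _ "\<lambda>x. if x = p then a else b"])
qed

text \<open>Two multiples a h and b h always satisfy the relation b (a h) - a (b h) = 0.\<close>

lemma lattice_rank_span_singleton:
  assumes "h \<noteq> 0"
  shows "lattice_rank (zvec.span {h}) = 1"
  unfolding lattice_rank_def
proof (rule Max_eqI)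
  have le: "card B \<le> 1" if B: "finite B" "B \<subseteq> zvec.span {h}" "zvec.independent B" for B
  proof (rule ccontr)
    assume "\<not> card B \<le> 1"
    then obtain x y where xy: "x \<in> B" "y \<in> B" "x \<noteq> y"
      using card_le_Suc0_iff_eq[OF B(1)] by auto
    have "x \<in> zvec.span {h}" "y \<in> zvec.span {h}" using xy B(2) by auto
    then obtain a b where ab: "x = a *s h" "y = b *s h"
      by (auto simp: zvec.span_singleton)
    have "b *s x + (- a) *s y = 0" by (simp add: ab vec_eq_iff)
    moreover have "b \<noteq> 0 \<or> - a \<noteq> 0" using ab xy(3) by auto
    ultimately have "zvec.dependent {x, y}" using zvec_dependent_pair_iff[OF xy(3)] by blast
    then show False using zvec.dependent_mono[of "{x, y}" B] xy B(3) by simp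
  qed
  then show "\<And>y. y \<in> {card B |B. finite B \<and> B \<subseteq> zvec.span {h} \<and> zvec.independent B} \<Longrightarrow> y \<le> 1"
    by blast
  then show "finite {card B |B. finite B \<and> B \<subseteq> zvec.span {h} \<and> zvec.independent B}"
    by (meson finite_nat_set_iff_bounded_le)
  have "zvec.independent {h}"
    using assms by (auto simp: zvec.dependent_finite vec_eq_iff)
  then show "1 \<in> {card B |B. finite B \<and> B \<subseteq> zvec.span {h} \<and> zvec.independent B}"
    using zvec.span_base[of h "{h}"] by (auto intro!: exI[of _ "{h}"])
qed

text \<open>The generator is a nonzero nonnegative lattice vector \<open>p\<close> of least
  coordinate sum; division with remainder by \<open>p\<close> must leave remainder 0.\<close>

lemma rank_1_generator:
  fixes A :: "int ^ 'n ^ 'm"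
  assumes rank: "lattice_rank (lattice_ker A) = 1" and np: "\<not> positive_lattice (lattice_ker A)"
  obtains p where "p \<in> lattice_ker A" "p \<in> nat_vecs" "p \<noteq> 0" "lattice_ker A \<subseteq> zvec.span {p}"
proof -
  let ?L = "lattice_ker A"
  let ?P = "\<lambda>p. p \<in> ?L \<and> p \<in> nat_vecs \<and> p \<noteq> 0"
  let ?n = "\<lambda>p::int^'n. nat (\<Sum>i\<in>UNIV. p $ i)"
  obtain p0 where "?P p0"
    using np lattice_ker_0[of A] nat_vecs_0 by (auto simp: positive_lattice_def)
  from ex_has_least_nat[of ?P, OF this, of ?n]
  obtain p where p: "p \<in> ?L" "p \<in> nat_vecs" "p \<noteq> 0" and least: "\<And>v. ?P v \<Longrightarrow> ?n p \<le> ?n v"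
    by blast
  obtain i where i: "p $ i > 0"
    using p by (auto simp: nat_vecs_def vec_eq_iff order_less_le)
  have "u \<in> zvec.span {p}" if u: "u \<in> ?L" for u
  proof (cases "u = p")
    case True
    then show ?thesis by (simp add: zvec.span_base)
  next
    case False
    have "zvec.dependent {p, u}"
      using card_le_lattice_rank[of "{p, u}" ?L] False p(1) u rank by auto
    then obtain a b where ab: "a \<noteq> 0 \<or> b \<noteq> 0" "a *s p + b *s u = 0"
      using zvec_dependent_pair_iff[of p u] False by blast
    have rel: "a * p $ j + b * u $ j = 0" for j
      using ab(2) by (simp add: vec_eq_iff)
    have b: "b \<noteq> 0" using rel[of i] ab(1) i by auto
    \<comment> \<open>Dividing in the single coordinate \<open>i\<close> suffices: \<open>r\<close>
      is proportional to \<open>p\<close>, so 0 \<le> r_i < p_i spreads to 0 \<le> r \<le> p in all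
      coordinates.\<close>
    define r where "r = u - (u $ i div p $ i) *s p"
    have ri: "0 \<le> r $ i" "r $ i < p $ i"
      using i by (simp_all add: r_def minus_div_mult_eq_mod)
    have proportional: "r $ j * p $ i = r $ i * p $ j" for j
    proof -
      have "b * (u $ j * p $ i) = b * (u $ i * p $ j)"
        using rel[of i] rel[of j] by algebra
      then have "u $ j * p $ i = u $ i * p $ j" using b by simp
      then show ?thesis by (simp add: r_def algebra_simps)
    qed
    have pj: "0 \<le> p $ j" for j using p(2) by (simp add: nat_vecs_def)
    have "0 \<le> r $ j * p $ i" for j using proportional ri(1) pj by simp
    have r0: "0 \<le> r $ j" for j
      using \<open>0 \<le> r $ j * p $ i\<close> i by (simp add: zero_le_mult_iff)
    have "r $ j * p $ i \<le> p $ j * p $ i" for j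
      using mult_right_mono[of "r $ i" "p $ i" "p $ j"] ri(2) pj[of j] proportional[of j]
      by (simp add: mult.commute)
    then have rp: "r $ j \<le> p $ j" for j using i by simp
    have rn: "r \<in> nat_vecs" using r0 by (simp add: nat_vecs_def)
    have rL: "r \<in> ?L" unfolding r_def by (intro lattice_ker_diff lattice_ker_scale u p(1))
    have "(\<Sum>i\<in>UNIV. r $ i) < (\<Sum>i\<in>UNIV. p $ i)"
      using rp ri by (intro sum_strict_mono_ex1) auto
    then have "\<not> ?n p \<le> ?n r"
      using sum_nat_vecs_pos[OF p(2,3)] by simp
    then have "r = 0" using least[of r] rn rL by blast
    then have "u = (u $ i div p $ i) *s p" by (simp add: r_def)
    then show ?thesis by (metis rangeI zvec.span_singleton)
  qed
  then show ?thesis using that p by blast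
qed

lemma move_steps_multiple:
  assumes "(p, 0) \<in> (move_step M)\<^sup>*" "p \<in> nat_vecs" "x \<in> nat_vecs"
  shows "(x + int n *s p, x) \<in> (move_step M)\<^sup>*"
proof (induction n)
  case (Suc n)
  have "(p + (x + int n *s p), 0 + (x + int n *s p)) \<in> (move_step M)\<^sup>*"
    using assms by (intro move_steps_translate nat_vecs_add nat_vecs_scale) auto
  moreover have "p + (x + int n *s p) = x + int (Suc n) *s p"
    by (simp add: vec_eq_iff algebra_simps)
  ultimately show ?case using Suc by (metis add_0 rtrancl_trans)
qed (simp add: vec_eq_iff)

lemma markov_basis_generator:
  assumes p: "p \<in> lattice_ker A" "p \<in> nat_vecs" and gen: "lattice_ker A \<subseteq> zvec.span {p}"
  shows "markov_basis A {p}"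
proof -
  have p0: "(p, 0) \<in> (move_step {p})\<^sup>*"
    using p(2) nat_vecs_0 by (intro r_into_rtrancl) (simp add: move_step_def)
  have "(w, u) \<in> (move_step {p})\<^sup>*"
    if wu: "w \<in> nat_vecs" "u \<in> nat_vecs" "A *v w = A *v u" for w u
  proof -
    have "w - u \<in> zvec.span {p}" using wu(3) gen by (auto simp: diff_in_lattice_ker_iff)
    then obtain k where k: "w - u = k *s p" by (auto simp: zvec.span_singleton)
    show ?thesis
    \<comment> \<open>The sign of \<open>k\<close> decides which of the two points is reached by
      subtracting copies of \<open>p\<close>.\<close>
    proof (cases "0 \<le> k")
      case True
      then have "w = u + int (nat k) *s p" using k by (simp add: algebra_simps)
      then show ?thesis using move_steps_multiple[OF p0 p(2) wu(2)] by metis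
    next
      case False
      then have "u = w + int (nat (- k)) *s p"
        using k by (simp add: vec_eq_iff algebra_simps)
      then have "(u, w) \<in> (move_step {p})\<^sup>*"
        using move_steps_multiple[OF p0 p(2) wu(1)] by metis
      then show ?thesis using sym_move_steps by (metis symD)
    qed
  qed
  then show ?thesis using p(1) by (simp add: markov_basis_def)
qed

text \<open>Conformal summands a h and b h agree in sign, but nonzero integers with a + b = 1 have
  opposite signs.\<close>

lemma generator_in_graver_basis:
  assumes h: "h \<in> lattice_ker A" "h \<noteq> 0" and gen: "lattice_ker A \<subseteq> zvec.span {h}"
  shows "h \<in> graver_basis A"
  unfolding graver_basis_def
proof (intro CollectI conjI notI)
  let ?L = "lattice_ker A"
  assume "\<exists>v\<in>?L. \<exists>w\<in>?L. v \<noteq> 0 \<and> w \<noteq> 0 \<and> h = v + w \<and>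
          pos_part h = pos_part v + pos_part w \<and> neg_part h = neg_part v + neg_part w"
  then obtain v w where vw: "v \<in> ?L" "w \<in> ?L" "v \<noteq> 0" "w \<noteq> 0" "h = v + w"
      "pos_part h = pos_part v + pos_part w" "neg_part h = neg_part v + neg_part w" by blast
  from vw(1,2) gen obtain a b where ab: "v = a *s h" "w = b *s h"
    by (force simp: zvec.span_singleton)
  obtain i where i: "h $ i \<noteq> 0" using h(2) by (auto simp: vec_eq_iff)
  have "h $ i = (a + b) * h $ i"
    using arg_cong[OF vw(5), of "\<lambda>x. x $ i"] ab by (simp add: algebra_simps)
  then have "a + b = 1" using i by simp
  moreover have "a \<noteq> 0" "b \<noteq> 0" using vw(3,4) ab by auto
  ultimately have "a * b < 0" by (smt (verit) mult_neg_pos mult_pos_neg)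
  moreover have "0 \<le> (v $ i) * (w $ i)"
  proof -
    have "max (h $ i) 0 = max (v $ i) 0 + max (w $ i) 0"
      "max (- h $ i) 0 = max (- v $ i) 0 + max (- w $ i) 0" "h $ i = v $ i + w $ i"
      using vw(5-7) by (simp_all add: vec_eq_iff pos_part_def neg_part_def)
    then have "0 \<le> v $ i \<and> 0 \<le> w $ i \<or> v $ i \<le> 0 \<and> w $ i \<le> 0" by (smt (verit))
    then show ?thesis by (simp add: zero_le_mult_iff)
  qed
  moreover have "(v $ i) * (w $ i) = (a * b) * (h $ i)\<^sup>2"
    by (simp add: ab power2_eq_square)
  moreover have "0 < (h $ i)\<^sup>2" using i by simp
  ultimately show False by (metis mult_neg_pos not_le)
qed (use h in auto)

section \<open>Replacing moves when the lattice is not positive\<close>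

text \<open>Some step of the path leaves 0 for a nonzero vertex \<open>h\<close>, and that step is
  \<open>h\<close> itself up to sign.\<close>

lemma move_steps_from_0:
  assumes "(0, y) \<in> (move_step M)\<^sup>*" "y \<noteq> 0"
  obtains h where "h \<in> nat_vecs" "h \<noteq> 0" "h \<in> M \<or> - h \<in> M"
proof -
  from assms have "\<exists>h\<in>nat_vecs. h \<noteq> 0 \<and> (h \<in> M \<or> - h \<in> M)"
  proof induction
    case (step y z)
    then show ?case by (cases "y = 0") (auto simp: move_step_def)
  qed simp
  with that show ?thesis by blast
qed

lemma least_markov_basis_not_subset_graver:
  assumes M: "markov_basis A M" and least: "\<And>M'. markov_basis A M' \<Longrightarrow> card M \<le> card M'"
    and h: "h \<in> nat_vecs" "h \<noteq> 0" "g \<in> M" "g = h \<or> g = - h" and u: "u \<in> M" "u \<noteq> g"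
  shows "\<not> universal_markov_basis A \<subseteq> graver_basis A"
proof
  assume sub: "universal_markov_basis A \<subseteq> graver_basis A"
  let ?L = "lattice_ker A"
  have fin: "finite M" and M_sub: "M \<subseteq> ?L" using M by (auto simp: markov_basis_def)
  have hL: "h \<in> ?L" using h(3,4) M_sub lattice_ker_neg[of g A] by auto
  \<comment> \<open>\<open>m\<close> exceeds every |u_i|, so \<open>q\<close> is positive on the
    support of \<open>h\<close>. One further copy of \<open>h\<close> then makes u' = q + h a
    conformal sum.\<close>
  define m where "m = nat (\<Sum>i\<in>UNIV. \<bar>u $ i\<bar>) + 1"
  define q where "q = u + int m *s h"
  define u' where "u' = u + int (Suc m) *s h"
  define N where "N = insert u' (M - {u})"
  have u': "u' = q + h" by (simp add: u'_def q_def vec_eq_iff algebra_simps)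
  have qL: "q \<in> ?L" unfolding q_def using u(1) M_sub hL
    by (intro lattice_ker_add lattice_ker_scale) auto
  have qpos: "0 < q $ i" if "h $ i \<noteq> 0" for i
  proof -
    have "\<bar>u $ i\<bar> \<le> (\<Sum>i\<in>UNIV. \<bar>u $ i\<bar>)" by (rule member_le_sum) auto
    then have "- (u $ i) < int m" by (simp add: m_def)
    moreover have "1 \<le> h $ i" using h(1) that by (simp add: nat_vecs_def) (smt (verit))
    then have "int m * 1 \<le> int m * h $ i" by (intro mult_left_mono) auto
    ultimately show ?thesis by (simp add: q_def)
  qed
  \<comment> \<open>The move \<open>g\<close> differs from \<open>u\<close>, so it survives in
    \<open>N\<close>.\<close>
  have h0: "(h, 0) \<in> (move_step N)\<^sup>*"
    using h u nat_vecs_0 by (intro r_into_rtrancl) (auto simp: move_step_def N_def)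
  have "markov_basis A N"
  proof (rule markov_basis_transfer[OF M])
    fix v assume v: "v \<in> M"
    show "(pos_part v, neg_part v) \<in> (move_step N)\<^sup>*"
    proof (cases "v = u")
      case True
      \<comment> \<open>Climb from u^+ by copies of \<open>h\<close>, then descend to u^- in one
        step along \<open>u'\<close>.\<close>
      let ?x = "pos_part u + int (Suc m) *s h"
      have "?x \<in> nat_vecs"
        using h(1) by (intro nat_vecs_add nat_vecs_scale pos_part_nat_vecs) auto
      moreover have "?x - neg_part u = u'"
        using pos_part_minus_neg_part[of u] by (simp add: u'_def algebra_simps)
      ultimately have "(?x, neg_part u) \<in> move_step N"
        by (simp add: move_step_def N_def neg_part_nat_vecs)
      moreover have "(pos_part u, ?x) \<in> (move_step N)\<^sup>*"
        using move_steps_multiple[OF h0 h(1) pos_part_nat_vecs] sym_move_steps by (metis symD)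
      ultimately show ?thesis using True by (meson rtrancl.rtrancl_into_rtrancl)
    next
      case False
      then have "(pos_part v, neg_part v) \<in> move_step N"
        using v by (simp add: move_step_def N_def pos_part_nat_vecs neg_part_nat_vecs
            pos_part_minus_neg_part)
      then show ?thesis by blast
    qed
  next
    show "N \<subseteq> ?L" using M_sub lattice_ker_add[OF qL hL] by (auto simp: N_def u')
  qed (simp add: N_def fin)
  \<comment> \<open>Only an inequality is claimed, since \<open>u'\<close> may already lie in
    \<open>M\<close>.\<close>
  moreover have "card N \<le> card M"
    using fin u(1) by (simp add: N_def card_insert_if card_Suc_Diff1 del: card_Diff_insert)
      (metis card_Suc_Diff1 card_Diff1_le order_refl)
  ultimately have "N \<subseteq> universal_markov_basis A"
    using least by (intro least_markov_basis_subset_universal) (auto intro: order_trans)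
  then have "u' \<in> graver_basis A" using sub by (auto simp: N_def)
  moreover have "q \<noteq> 0" using qpos h(2) by (force simp: vec_eq_iff)
  moreover have "pos_part u' = pos_part q + pos_part h \<and> neg_part u' = neg_part q + neg_part h"
  proof -
    have "max (q $ i + h $ i) 0 = max (q $ i) 0 + max (h $ i) 0 \<and>
      max (- q $ i - h $ i) 0 = max (- q $ i) 0 + max (- h $ i) 0" for i
      using qpos[of i] h(1) by (cases "h $ i = 0") (auto simp: nat_vecs_def dest: spec[of _ i])
    then show ?thesis by (simp add: u' vec_eq_iff pos_part_def neg_part_def)
  qed
  ultimately show False using qL hL h(2) u' unfolding graver_basis_def by blast
qed

section \<open>The equivalence, by cases on positivity of the lattice\<close>

theorem theorem2p3:
  fixes A :: "int ^ 'n ^ 'm"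
  defines "L \<equiv> lattice_ker A"
  shows "universal_markov_basis A \<subseteq> graver_basis A \<longleftrightarrow>
           positive_lattice L \<or> (L = pure_sublattice L \<and> lattice_rank L = 1)"
proof
  assume sub: "universal_markov_basis A \<subseteq> graver_basis A"
  show "positive_lattice L \<or> (L = pure_sublattice L \<and> lattice_rank L = 1)"
  proof (cases "positive_lattice L")
    case False
    obtain M where M: "markov_basis A M" and least: "\<And>M'. markov_basis A M' \<Longrightarrow> card M \<le> card M'"
      using markov_basis_exists[of A] ex_has_least_nat[of "markov_basis A" _ card] by metis
    obtain p where p: "p \<in> L" "p \<in> nat_vecs" "p \<noteq> 0"
      using False lattice_ker_0[of A] nat_vecs_0 by (auto simp: positive_lattice_def L_def)
    have "A *v 0 = A *v p" using p(1) by (simp add: L_def lattice_ker_def)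
    then have "(0, p) \<in> (move_step M)\<^sup>*"
      using M p(2) nat_vecs_0 unfolding markov_basis_def by blast
    then obtain h where h: "h \<in> nat_vecs" "h \<noteq> 0" "h \<in> M \<or> - h \<in> M"
      by (rule move_steps_from_0[OF _ p(3)])
    then obtain g where g: "g \<in> M" "g = h \<or> g = - h" by blast
    have "M \<subseteq> {g}"
      using least_markov_basis_not_subset_graver[OF M least h(1,2) g] sub by blast
    have hL: "h \<in> L"
      using g M lattice_ker_neg[of g A] by (auto simp: markov_basis_def L_def)
    have "M \<subseteq> zvec.span {h}"
      using \<open>M \<subseteq> {g}\<close> g zvec.span_base[of h "{h}"] zvec.span_neg[of h "{h}"] by auto
    then have "L \<subseteq> zvec.span {h}"
      unfolding L_def using markov_basis_subspace[OF M zvec.subspace_span] by blast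
    moreover have "zvec.span {h} \<subseteq> pure_sublattice L"
      unfolding pure_sublattice_def using hL h(1) by (intro zvec.span_mono) auto
    moreover have "pure_sublattice L \<subseteq> L"
      unfolding pure_sublattice_def L_def by (rule zvec.span_minimal) (auto simp: lattice_ker_subspace)
    ultimately show ?thesis
      using lattice_rank_span_singleton[OF h(2)] by (metis subset_antisym subset_trans)
  qed simp
next
  assume "positive_lattice L \<or> (L = pure_sublattice L \<and> lattice_rank L = 1)"
  then consider "positive_lattice L" | "\<not> positive_lattice L" "lattice_rank L = 1" by blast
  then show "universal_markov_basis A \<subseteq> graver_basis A"
  proof cases
    case 1
    then show ?thesis
      unfolding universal_markov_basis_def L_def using minimal_markov_basis_subset_graver by blast
  next
    case 2
    then obtain p where p: "p \<in> L" "p \<in> nat_vecs" "p \<noteq> 0" "L \<subseteq> zvec.span {p}"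
      unfolding L_def by (metis rank_1_generator)
    \<comment> \<open>A Markov basis inside {0} would generate only the zero lattice. Hence the
      least cardinality is 1, attained by \<open>{p}\<close>.\<close>
    have nontrivial: "M \<noteq> {}" "M \<noteq> {0}" if "markov_basis A M" for M
      using markov_basis_subspace[OF that zvec.subspace_single_0] p by (auto simp: L_def)
    have "markov_basis A {p}" using p by (intro markov_basis_generator) (auto simp: L_def)
    then have minp: "minimal_markov_basis A {p}"
      unfolding minimal_markov_basis_def using nontrivial by blast
    have "M \<subseteq> graver_basis A" if M: "minimal_markov_basis A M"
      and least: "\<And>M'. minimal_markov_basis A M' \<Longrightarrow> card M \<le> card M'" for M
    proof -
      have mb: "markov_basis A M" using M by (simp add: minimal_markov_basis_def)
      then have "card M \<noteq> 0" using nontrivial by (simp add: markov_basis_def)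
      with least[OF minp] have "card M = 1" by simp
      then obtain h where h: "M = {h}" by (rule card_1_singletonE)
      \<comment> \<open>Any competing basis of least cardinality is a singleton whose element again
        generates the lattice.\<close>
      have "lattice_ker A \<subseteq> zvec.span {h}"
        using markov_basis_subspace[OF mb zvec.subspace_span] h zvec.span_base by blast
      moreover have "h \<noteq> 0" using nontrivial[OF mb] h by auto
      moreover have "h \<in> lattice_ker A" using mb h by (simp add: markov_basis_def)
      ultimately show ?thesis using generator_in_graver_basis h by blast
    qed
    then show ?thesis unfolding universal_markov_basis_def by blast
  qed
qed

end
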